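(* Let $n,k,t\ge1$ be integers and $\mathcal{A}\subset 2^{[n]}$ a family. Let $\mathcal{F}\subset\mathcal{A}\cap\binom{[n]}{\le k}$ be $t$-intersecting. Let $q,r,r_0\ge1$ satisfy $r>2^{12}\log_2(2k)$, $r\ge 2q$ and $r_0>r$, and assume $\mathcal{A}$ is $r_0$-spread. Then there exist a $t$-intersecting family $\mathcal{S}$ of sets of size at most $q$ and a family $\mathcal{F}'\subset\mathcal{F}$ such that (i) $\mathcal{F}\setminus\mathcal{F}'\subset\mathcal{A}[\mathcal{S}]$; (ii) for every $B\in\mathcal{S}$ there is a family $\mathcal{F}_B\subset\mathcal{F}$ such that $\mathcal{F}_B(B)$ is $r$-spread; (iii) $|\mathcal{F}'|\le (r_0/r)^{-q-1}|\mathcal{A}|$.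
   Context: $\binom{[n]}{\le k}$ is the family of subsets of $[n]$ of size at most $k$. For $X\subset[n]$ and $\mathcal{G}\subset 2^{[n]}$: $\mathcal{G}(X)=\{G\setminus X: G\in\mathcal{G},\ X\subset G\}$ (a family on $[n]\setminus X$), $\mathcal{G}[X]=\{G\in\mathcal{G}: X\subset G\}$, and for a family $\mathcal{S}$, $\mathcal{G}[\mathcal{S}]=\bigcup_{S\in\mathcal{S}}\mathcal{G}[S]$. For real $r>1$, a family $\mathcal{G}$ is $r$-spread if $|\mathcal{G}(X)|\le r^{-|X|}|\mathcal{G}|$ for every set $X$. A family is $t$-intersecting if any two (not necessarily distinct) members share at least $t$ elements.
   Formalization: q is taken to be an integer; for non-integer real q the claim fails (e.g. q=1.5, k=t=2, r=2^14, A all transversals of two m-sets with r_0=m>r^5, F a single transversal). Also the spread families F_B(B) in (ii) are required to be nonempty, which is stronger. *)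

theory Defs
  imports Complex_Main
begin

definition link :: "'a set set \<Rightarrow> 'a set \<Rightarrow> 'a set set" where
  "link G X = {H - X | H. H \<in> G \<and> X \<subseteq> H}"

definition star :: "'a set set \<Rightarrow> 'a set \<Rightarrow> 'a set set" where
  "star G X = {H \<in> G. X \<subseteq> H}"

definition star_family :: "'a set set \<Rightarrow> 'a set set \<Rightarrow> 'a set set" where
  "star_family G \<S> = (\<Union>S\<in>\<S>. star G S)"

text \<open>
  Only used for finite families of finite sets and for \<open>r > 1\<close>. The empty family is
  \<open>r\<close>-spread for every \<open>r\<close>; nonemptiness has to be asked for separately.
\<close>
definition spread :: "real \<Rightarrow> 'a set set \<Rightarrow> bool" where
  "spread r G \<longleftrightarrow>
     (\<forall>X. finite X \<longrightarrow> real (card (link G X)) \<le> r powi (- int (card X)) * real (card G))"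

text \<open>The case \<open>A = B\<close> is included, so every member has at least \<open>t\<close> elements.\<close>
definition t_intersecting :: "nat \<Rightarrow> 'a set set \<Rightarrow> bool" where
  "t_intersecting t G \<longleftrightarrow> (\<forall>A\<in>G. \<forall>B\<in>G. t \<le> card (A \<inter> B))"

definition subsets_upto :: "nat \<Rightarrow> nat \<Rightarrow> nat set set" where
  "subsets_upto n k = {X. X \<subseteq> {1..n} \<and> card X \<le> k}"

end

theory Submission
  imports Defs
begin

text \<open>
  Greedily pick an inclusion-maximal \<open>S\<close> such that the sets containing \<open>S\<close> make up at least a
  fraction \<open>1 / r\<close> to the power \<open>|S|\<close> of the remaining family, and remove these sets; by maximality their link at
  \<open>S\<close> is \<open>r\<close>-spread. Stop when \<open>|S| > q\<close>: then spreadness of \<open>\<A>\<close> bounds what remains.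

  If two of the chosen sets \<open>A\<close>, \<open>B\<close> had fewer than \<open>t\<close> common elements, then, as \<open>r \<ge> 2q\<close>, at
  least half of each link avoids the other set. A uniformly random \<open>W \<subseteq> V\<close> contains a member of
  each half-link with probability above \<open>1/2\<close>, so for some \<open>W\<close> one half-link has a member inside
  \<open>W\<close> and the other one outside, and these extend to members of \<open>\<F>\<close> meeting in \<open>A \<inter> B\<close> only.

  The probability estimate follows Park and Pham. The random set is a union of
  \<open>m \<le> log\<^sub>2 (2k)\<close> independent sparse samples. After each sample, the inclusion-minimal sets
  \<open>S - W\<close> that did not shrink by half are put into a cover and the others form the next family. On
  failure the cover covers the whole family, so by spreadness has cost bounded below, whereas its
  expected cost is small.
\<close>

section \<open>Random subsets of a given density\<close>

text \<open>The expectation of \<open>f W\<close> when \<open>W \<subseteq> V\<close> contains each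
  point independently with probability \<open>a\<close>.\<close>

definition bexp :: "real \<Rightarrow> 'a set \<Rightarrow> ('a set \<Rightarrow> real) \<Rightarrow> real" where
  "bexp a V f = (\<Sum>W\<in>Pow V. a ^ card W * (1 - a) ^ card (V - W) * f W)"

lemma bexp_empty [simp]: "bexp a {} f = f {}"
  by (simp add: bexp_def)

lemma bexp_insert:
  assumes "finite V" "x \<notin> V"
  shows "bexp a (insert x V) f = a * bexp a V (\<lambda>W. f (insert x W)) + (1 - a) * bexp a V f"
proof -
  have inj: "inj_on (insert x) (Pow V)"
    using assms(2) by (auto simp: inj_on_def)
  have disj: "Pow V \<inter> insert x ` Pow V = {}"
    using assms(2) by auto
  have 1: "a ^ card W * (1 - a) ^ card (insert x V - W) * f W =
      (1 - a) * (a ^ card W * (1 - a) ^ card (V - W) * f W)" if "W \<in> Pow V" for W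
  proof -
    have "insert x V - W = insert x (V - W)"
      using that assms(2) by auto
    then show ?thesis
      using assms by simp
  qed
  have 2: "a ^ card (insert x W) * (1 - a) ^ card (insert x V - insert x W) * f (insert x W) =
      a * (a ^ card W * (1 - a) ^ card (V - W) * f (insert x W))" if "W \<in> Pow V" for W
  proof -
    have "insert x V - insert x W = V - W" "x \<notin> W" "finite W"
      using that assms finite_subset by auto
    then show ?thesis
      by simp
  qed
  let ?h = "\<lambda>W. a ^ card W * (1 - a) ^ card (insert x V - W) * f W"
  have "bexp a (insert x V) f = sum ?h (Pow V) + sum ?h (insert x ` Pow V)"
    unfolding bexp_def Pow_insert using assms(1) disj by (intro sum.union_disjoint) auto
  also have "sum ?h (insert x ` Pow V) = (\<Sum>W\<in>Pow V. ?h (insert x W))"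
    by (simp only: sum.reindex[OF inj] o_def)
  also have "\<dots> = a * bexp a V (\<lambda>W. f (insert x W))"
    unfolding bexp_def sum_distrib_left by (rule sum.cong[OF refl 2])
  also have "sum ?h (Pow V) = (1 - a) * bexp a V f"
    unfolding bexp_def sum_distrib_left by (rule sum.cong[OF refl 1])
  finally show ?thesis by simp
qed

lemma bexp_add: "bexp a V (\<lambda>W. f W + g W) = bexp a V f + bexp a V g"
  by (simp add: bexp_def distrib_left sum.distrib)

lemma bexp_cmult: "bexp a V (\<lambda>W. c * f W) = c * bexp a V f"
  unfolding bexp_def sum_distrib_left by (rule sum.cong) auto

lemma bexp_const: "finite V \<Longrightarrow> bexp a V (\<lambda>W. c) = c"
  by (induction V rule: finite_induct) (simp_all add: bexp_insert algebra_simps)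

lemma bexp_mono:
  assumes "0 \<le> a" "a \<le> 1" "\<And>W. W \<subseteq> V \<Longrightarrow> f W \<le> g W"
  shows "bexp a V f \<le> bexp a V g"
  unfolding bexp_def using assms by (intro sum_mono mult_left_mono) auto

text \<open>A point avoids the union of two independent samples with probability
  \<open>(1 - a) * (1 - b)\<close>. Iterating this splits one sample into many sparse ones.\<close>

lemma bexp_union:
  assumes "finite V"
  shows "bexp a V (\<lambda>A. bexp b V (\<lambda>B. f (A \<union> B))) = bexp (1 - (1 - a) * (1 - b)) V f"
  using assms
proof (induction V arbitrary: f rule: finite_induct)
  case (insert x V)
  let ?c = "1 - (1 - a) * (1 - b)"
  let ?g = "\<lambda>W. f (insert x W)"
  \<comment> \<open>The four cases of \<open>x \<in> A\<close> and \<open>x \<in> B\<close>; three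
    of them put \<open>x\<close> into \<open>A \<union> B\<close>.\<close>
  have "bexp a (insert x V) (\<lambda>A. bexp b (insert x V) (\<lambda>B. f (A \<union> B))) =
      a * (b * bexp a V (\<lambda>A. bexp b V (\<lambda>B. ?g (A \<union> B)))
        + (1 - b) * bexp a V (\<lambda>A. bexp b V (\<lambda>B. ?g (A \<union> B))))
      + (1 - a) * (b * bexp a V (\<lambda>A. bexp b V (\<lambda>B. ?g (A \<union> B)))
        + (1 - b) * bexp a V (\<lambda>A. bexp b V (\<lambda>B. f (A \<union> B))))"
    unfolding bexp_insert[OF insert.hyps]
    by (simp add: bexp_add bexp_cmult)
  also have "\<dots> = ?c * bexp ?c V ?g + (1 - ?c) * bexp ?c V f"
    unfolding insert.IH[of f] insert.IH[of ?g] by (simp add: algebra_simps)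
  finally show ?case
    using insert.hyps by (simp add: bexp_insert)
qed simp

section \<open>Covers, minimal fragments and the cost estimate\<close>

definition covers :: "'a set set \<Rightarrow> 'a set set \<Rightarrow> bool" where
  "covers U H \<longleftrightarrow> (\<forall>S\<in>H. \<exists>T\<in>U. T \<subseteq> S)"

text \<open>The expected number of members of \<open>U\<close> inside a random set of density
  \<open>p\<close>. For \<open>p = 1 / r\<close> it bounds the share of an \<open>r\<close>-spread
  family that \<open>U\<close> can cover.\<close>

definition cost :: "real \<Rightarrow> 'a set set \<Rightarrow> real" where
  "cost p U = (\<Sum>T\<in>U. p ^ card T)"

text \<open>Real-valued, so that \<open>bexp\<close> turns it into the probability of
  failure.\<close>

definition misses :: "'a set set \<Rightarrow> 'a set \<Rightarrow> real" where
  "misses H W = of_bool (\<forall>S\<in>H. \<not> S \<subseteq> W)"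

definition fragments :: "'a set set \<Rightarrow> 'a set \<Rightarrow> 'a set set" where
  "fragments H W = {T. (\<exists>S\<in>H. T = S - W) \<and> (\<forall>S\<in>H. S - W \<subseteq> T \<longrightarrow> S - W = T)}"

lemma fragments_subset:
  assumes "H \<subseteq> Pow V"
  shows "fragments H W \<subseteq> Pow V"
  using assms unfolding fragments_def by auto

text \<open>All minimal fragments together cover \<open>H\<close>, so the large ones and a cover of
  the small ones do as well.\<close>

lemma fragment_below:
  assumes "finite H" "S \<in> H"
  obtains T where "T \<in> fragments H W" "T \<subseteq> S"
proof -
  have "finite ((\<lambda>S. S - W) ` H)" "S - W \<in> (\<lambda>S. S - W) ` H"
    using assms by auto
  from finite_has_minimal2[OF this] obtain T where T: "T \<in> (\<lambda>S. S - W) ` H" "T \<subseteq> S - W"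
    and min: "\<forall>T'\<in>(\<lambda>S. S - W) ` H. T' \<subseteq> T \<longrightarrow> T = T'"
    by (elim bexE conjE) (rule that)
  then have "T \<in> fragments H W"
    unfolding fragments_def by auto
  with T(2) show thesis
    using that by auto
qed

text \<open>
  A pair \<open>(W, T)\<close> with \<open>T\<close> a minimal fragment is determined by \<open>Z = W \<union> T\<close> and \<open>T\<close>. Moreover any
  member \<open>S\<close> of \<open>H\<close> inside \<open>Z\<close> satisfies \<open>S - W \<subseteq> T\<close>, whence \<open>T \<subseteq> S\<close> by minimality; so a given
  \<open>Z\<close> leaves at most \<open>2\<^sup>l\<close> choices for \<open>T\<close>.
\<close>

lemma large_fragments_cost:
  assumes V: "finite V" and H: "H \<subseteq> Pow V" and size: "\<And>S. S \<in> H \<Longrightarrow> card S \<le> l"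
    and \<rho>: "0 < \<rho>" "\<rho> \<le> 1" and p: "0 \<le> p" "p \<le> \<rho>"
  shows "bexp \<rho> V (\<lambda>W. cost p {T \<in> fragments H W. s \<le> card T}) \<le> 2 ^ l * (p / \<rho>) ^ s"
proof -
  define \<mu> where "\<mu> W = \<rho> ^ card W * (1 - \<rho>) ^ card (V - W)" for W
  define L where "L W = {T \<in> fragments H W. s \<le> card T}" for W
  define M where "M Z = {T. \<exists>W. W \<subseteq> V \<and> T \<in> L W \<and> Z = W \<union> T}" for Z
  have \<mu>0: "0 \<le> \<mu> W" for W
    unfolding \<mu>_def using \<rho> by auto
  have finL: "finite (L W)" and LV: "L W \<subseteq> Pow V" for W
    using fragments_subset[OF H, of W] V unfolding L_def by (auto intro: finite_subset)
  have Ldisj: "T \<inter> W = {}" if "T \<in> L W" for T W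
    using that unfolding L_def fragments_def by auto
  have MV: "M Z \<subseteq> Pow V" for Z
    using LV unfolding M_def by auto
  then have finM: "finite (M Z)" for Z
    using V by (meson finite_Pow_iff finite_subset)
  \<comment> \<open>Adding \<open>T\<close> to \<open>W\<close> turns \<open>card T\<close> factors
    \<open>1 - \<rho>\<close> into factors \<open>\<rho>\<close>; the factors
    \<open>1 - \<rho>\<close> lost on the way are at most 1.\<close>
  have weight: "\<mu> W * p ^ card T \<le> \<mu> (W \<union> T) * (p / \<rho>) ^ card T"
    if "W \<subseteq> V" "T \<in> L W" for W T
  proof -
    have T: "T \<subseteq> V" "T \<inter> W = {}"
      using that LV Ldisj by auto
    then have fin: "finite W" "finite T"
      using that(1) V by (auto intro: finite_subset)
    have 1: "card (W \<union> T) = card W + card T"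
      using fin T by (simp add: card_Un_disjoint inf_commute)
    have "V - W = (V - (W \<union> T)) \<union> T" "(V - (W \<union> T)) \<inter> T = {}"
      using T by auto
    then have 2: "card (V - W) = card (V - (W \<union> T)) + card T"
      using fin V by (metis card_Un_disjoint finite_Diff)
    have "\<mu> W * p ^ card T =
        \<rho> ^ card W * (1 - \<rho>) ^ card (V - (W \<union> T)) * p ^ card T * (1 - \<rho>) ^ card T"
      unfolding \<mu>_def 2 by (simp add: power_add)
    also have "\<dots> \<le> \<rho> ^ card W * (1 - \<rho>) ^ card (V - (W \<union> T)) * p ^ card T * 1"
      using \<rho> p by (intro mult_left_mono power_le_one) auto
    also have "\<dots> = \<mu> (W \<union> T) * (p / \<rho>) ^ card T"
      unfolding \<mu>_def 1 using \<rho> by (simp add: power_add power_divide)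
    finally show ?thesis .
  qed
  have inner: "(\<Sum>T\<in>M Z. (p / \<rho>) ^ card T) \<le> 2 ^ l * (p / \<rho>) ^ s" for Z
  proof (cases "M Z = {}")
    case True
    then show ?thesis using p \<rho> by simp
  next
    case False
    then obtain W0 T0 where "T0 \<in> L W0" "Z = W0 \<union> T0"
      unfolding M_def by auto
    then obtain S where S: "S \<in> H" "S \<subseteq> Z"
      unfolding L_def fragments_def by auto
    have "T \<subseteq> S" if "T \<in> M Z" for T
    proof -
      obtain W where W: "T \<in> L W" "Z = W \<union> T"
        using \<open>T \<in> M Z\<close> unfolding M_def by auto
      then have "S - W \<subseteq> T"
        using S by auto
      then have "S - W = T"
        using W(1) S(1) unfolding L_def fragments_def by auto
      then show ?thesis by auto
    qed
    then have sub: "M Z \<subseteq> Pow S" by auto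
    have finS: "finite S"
      using S H V by (auto intro: finite_subset)
    have "card (M Z) \<le> 2 ^ card S"
      using card_mono[OF _ sub] finS by (simp add: card_Pow)
    also have "(2::nat) ^ card S \<le> 2 ^ l"
      using size[OF S(1)] by (simp add: power_increasing)
    finally have cardM: "real (card (M Z)) \<le> 2 ^ l"
      by (metis of_nat_le_iff of_nat_numeral of_nat_power)
    have "(\<Sum>T\<in>M Z. (p / \<rho>) ^ card T) \<le> (\<Sum>T\<in>M Z. (p / \<rho>) ^ s)"
    proof (rule sum_mono)
      fix T assume "T \<in> M Z"
      then have "s \<le> card T"
        unfolding M_def L_def by auto
      then show "(p / \<rho>) ^ card T \<le> (p / \<rho>) ^ s"
        using p \<rho> by (intro power_decreasing) auto
    qed
    also have "\<dots> \<le> 2 ^ l * (p / \<rho>) ^ s"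
      using cardM p \<rho> by (simp add: mult_right_mono)
    finally show ?thesis .
  qed
  have inj: "inj_on (\<lambda>(W, T). (W \<union> T, T)) (SIGMA W:Pow V. L W)"
  proof (rule inj_onI, clarsimp)
    fix W W' T
    assume "T \<in> L W" "T \<in> L W'" "W \<union> T = W' \<union> T"
    then show "W = W'"
      using Ldisj[of T W] Ldisj[of T W'] by blast
  qed
  have img: "(\<lambda>(W, T). (W \<union> T, T)) ` (SIGMA W:Pow V. L W) \<subseteq> (SIGMA Z:Pow V. M Z)"
  proof clarify
    fix W T assume "W \<subseteq> V" "T \<in> L W"
    then show "W \<union> T \<in> Pow V \<and> T \<in> M (W \<union> T)"
      using LV[of W] unfolding M_def by blast
  qed
  have "bexp \<rho> V (\<lambda>W. cost p (L W)) = (\<Sum>W\<in>Pow V. \<Sum>T\<in>L W. \<mu> W * p ^ card T)"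
    unfolding bexp_def cost_def \<mu>_def by (simp add: sum_distrib_left)
  also have "\<dots> = (\<Sum>(W, T)\<in>(SIGMA W:Pow V. L W). \<mu> W * p ^ card T)"
    using V finL by (subst sum.Sigma) auto
  also have "\<dots> \<le> (\<Sum>(W, T)\<in>(SIGMA W:Pow V. L W). \<mu> (W \<union> T) * (p / \<rho>) ^ card T)"
    using weight by (intro sum_mono) auto
  also have "\<dots> = (\<Sum>(Z, T)\<in>(\<lambda>(W, T). (W \<union> T, T)) ` (SIGMA W:Pow V. L W).
      \<mu> Z * (p / \<rho>) ^ card T)"
    by (subst sum.reindex[OF inj]) (auto intro: sum.cong)
  also have "\<dots> \<le> (\<Sum>(Z, T)\<in>(SIGMA Z:Pow V. M Z). \<mu> Z * (p / \<rho>) ^ card T)"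
    using V finM \<mu>0 p \<rho> by (intro sum_mono2 img) auto
  also have "\<dots> = (\<Sum>Z\<in>Pow V. \<mu> Z * (\<Sum>T\<in>M Z. (p / \<rho>) ^ card T))"
    using V finM by (subst sum.Sigma[symmetric]) (auto simp: sum_distrib_left)
  also have "\<dots> \<le> (\<Sum>Z\<in>Pow V. \<mu> Z * (2 ^ l * (p / \<rho>) ^ s))"
    using \<mu>0 inner by (intro sum_mono mult_left_mono) auto
  also have "\<dots> = bexp \<rho> V (\<lambda>Z. 2 ^ l * (p / \<rho>) ^ s)"
    unfolding bexp_def \<mu>_def ..
  also have "\<dots> = 2 ^ l * (p / \<rho>) ^ s"
    using V by (rule bexp_const)
  finally show ?thesis
    unfolding L_def .
qed

text \<open>
  The number \<open>c\<close> stands for the least cost of a cover of \<open>H\<close>. For a fixed sample \<open>W\<close> the large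
  fragments, together with any cover of the small ones, cover \<open>H\<close>; hence the least cover cost of
  the small fragments is at least \<open>c\<close> minus the cost of the large ones.
\<close>

lemma cover_cost_mult_misses:
  fixes V :: "'a set"
  assumes V: "finite V" and \<rho>: "0 < \<rho>" "\<rho> \<le> 1" and p: "0 \<le> p" "p \<le> \<rho>" "4 * (p / \<rho>) \<le> 1 / 8"
    and H: "H \<subseteq> Pow V" and size: "\<And>S. S \<in> H \<Longrightarrow> card S < 2 ^ m"
    and c: "\<And>U. U \<subseteq> Pow V \<Longrightarrow> covers U H \<Longrightarrow> c \<le> cost p U"
  shows "c * bexp (1 - (1 - \<rho>) ^ m) V (misses H) \<le> (1 - (1 / 8) ^ m) / 7"
  using H size c
proof (induction m arbitrary: H c)
  case 0
  \<comment> \<open>Only the empty set has size below \<open>2 ^ 0\<close>. If \<open>H\<close> is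
    empty, the empty cover gives \<open>c \<le> 0\<close>; otherwise \<open>{} \<in> H\<close> is
    never missed.\<close>
  have "misses H W * c \<le> 0" for W
  proof (cases "H = {}")
    case True
    then have "c \<le> 0"
      using 0(3)[where U = "{}"] by (simp add: covers_def cost_def)
    then show ?thesis
      by (simp add: misses_def)
  next
    case False
    then obtain S where "S \<in> H" by auto
    then have "S = {}"
      using 0(1) 0(2)[of S] V
      by (metis PowD card_0_eq finite_subset less_one power_0 subsetD)
    with \<open>S \<in> H\<close> show ?thesis
      by (auto simp: misses_def)
  qed
  then have "bexp 0 V (\<lambda>W. c * misses H W) \<le> bexp 0 V (\<lambda>W. 0)"
    by (intro bexp_mono) (auto simp: mult.commute)
  then show ?case
    using V by (simp add: bexp_cmult bexp_const)
next
  case (Suc m)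
  \<comment> \<open>The density of the union of the \<open>m\<close> samples that remain after the
    first one, \<open>W\<close>. The induction hypothesis is applied to the small fragments and to a
    lowered \<open>c\<close>.\<close>
  let ?a = "1 - (1 - \<rho>) ^ m"
  have a: "0 \<le> ?a" "?a \<le> 1"
    using \<rho> by (auto simp: power_le_one)
  define L where "L W = {T \<in> fragments H W. 2 ^ m \<le> card T}" for W
  define K where "K W = {T \<in> fragments H W. card T < 2 ^ m}" for W
  have finH: "finite H"
    using Suc.prems(1) V by (meson finite_Pow_iff finite_subset)
  have LV: "L W \<subseteq> Pow V" and KV: "K W \<subseteq> Pow V" for W
    using fragments_subset[OF Suc.prems(1), of W] unfolding L_def K_def by auto
  have cost0: "0 \<le> cost p U" for U :: "'a set set"
    using p unfolding cost_def by (intro sum_nonneg) auto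
  have small: "(c - cost p (L W)) * bexp ?a V (misses (K W)) \<le> (1 - (1 / 8) ^ m) / 7" for W
  proof (rule Suc.IH)
    show "K W \<subseteq> Pow V" by (rule KV)
    show "card S < 2 ^ m" if "S \<in> K W" for S
      using that unfolding K_def by auto
    fix U assume U: "U \<subseteq> Pow V" "covers U (K W)"
    have "covers (L W \<union> U) H"
      unfolding covers_def
    proof
      fix S assume "S \<in> H"
      then obtain T where T: "T \<in> fragments H W" "T \<subseteq> S"
        using fragment_below[OF finH] by blast
      show "\<exists>T\<in>L W \<union> U. T \<subseteq> S"
      proof (cases "2 ^ m \<le> card T")
        case True
        then have "T \<in> L W"
          using T(1) unfolding L_def by simp
        then show ?thesis
          using T(2) by (intro bexI[of _ T]) auto
      next
        case False
        then have "T \<in> K W"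
          using T(1) unfolding K_def by simp
        then obtain T' where "T' \<in> U" "T' \<subseteq> T"
          using U(2) unfolding covers_def by auto
        then show ?thesis
          using T(2) by (intro bexI[of _ T']) auto
      qed
    qed
    then have "c \<le> cost p (L W \<union> U)"
      using Suc.prems(3) U(1) LV by auto
    also have "\<dots> \<le> cost p (L W) + cost p U"
    proof -
      have "finite (L W)" "finite U"
        using LV U(1) V by (meson finite_Pow_iff finite_subset)+
      then have "cost p (L W \<union> U) + cost p (L W \<inter> U) = cost p (L W) + cost p U"
        unfolding cost_def by (rule sum.union_inter)
      then show ?thesis
        using cost0[of "L W \<inter> U"] by linarith
    qed
    finally show "c - cost p (L W) \<le> cost p U" by linarith
  qed
  have step: "c * bexp ?a V (\<lambda>B. misses H (W \<union> B)) \<le> (1 - (1 / 8) ^ m) / 7 + cost p (L W)" for W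
  proof (cases "c \<le> 0")
    case True
    \<comment> \<open>For \<open>c \<le> 0\<close> the left side is nonpositive. The other case
      multiplies an inequality by \<open>c\<close> and needs its sign.\<close>
    have "0 \<le> bexp ?a V (\<lambda>B. misses H (W \<union> B))"
      using bexp_mono[OF a, of V "\<lambda>_. 0" "\<lambda>B. misses H (W \<union> B)"] V
      by (simp add: bexp_const misses_def)
    then have "c * bexp ?a V (\<lambda>B. misses H (W \<union> B)) \<le> 0"
      using True by (rule mult_nonpos_nonneg[rotated])
    moreover have "0 \<le> (1 - (1 / 8 :: real) ^ m) / 7"
      by (simp add: power_le_one)
    ultimately show ?thesis
      using cost0[of "L W"] by linarith
  next
    case False
    \<comment> \<open>If \<open>B\<close> contains a fragment \<open>S - W\<close>, then
      \<open>S \<subseteq> W \<union> B\<close>; so if \<open>W \<union> B\<close> misses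
      \<open>H\<close>, then \<open>B\<close> misses \<open>K W\<close>.\<close>
    have "bexp ?a V (\<lambda>B. misses H (W \<union> B)) \<le> bexp ?a V (misses (K W))"
      by (rule bexp_mono[OF a]) (fastforce simp: misses_def K_def fragments_def)
    then have "c * bexp ?a V (\<lambda>B. misses H (W \<union> B)) \<le> c * bexp ?a V (misses (K W))"
      using False by (intro mult_left_mono) auto
    moreover have "cost p (L W) * bexp ?a V (misses (K W)) \<le> cost p (L W) * 1"
      using bexp_mono[OF a, of V "misses (K W)" "\<lambda>_. 1"] V
      by (intro mult_left_mono cost0) (simp add: bexp_const misses_def)
    ultimately show ?thesis
      using small[of W] unfolding left_diff_distrib by linarith
  qed
  have "c * bexp (1 - (1 - \<rho>) ^ Suc m) V (misses H) =
      bexp \<rho> V (\<lambda>W. c * bexp ?a V (\<lambda>B. misses H (W \<union> B)))"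
    using bexp_union[OF V, of \<rho> ?a "misses H"] by (simp add: bexp_cmult)
  also have "\<dots> \<le> bexp \<rho> V (\<lambda>W. (1 - (1 / 8) ^ m) / 7 + cost p (L W))"
    using \<rho> step by (intro bexp_mono) auto
  also have "\<dots> = (1 - (1 / 8) ^ m) / 7 + bexp \<rho> V (\<lambda>W. cost p (L W))"
    using V by (simp add: bexp_add bexp_const)
  also have "bexp \<rho> V (\<lambda>W. cost p (L W)) \<le> 2 ^ (2 ^ Suc m) * (p / \<rho>) ^ (2 ^ m)"
    unfolding L_def using Suc.prems(2)
    by (intro large_fragments_cost V Suc.prems(1) \<rho> p less_imp_le)
  \<comment> \<open>The factor \<open>2 ^ (2 ^ Suc m)\<close> is \<open>4 ^ (2 ^ m)\<close>: the
    size bound is twice the threshold for large fragments. Below, \<open>Suc m \<le> 2 ^ m\<close>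
    is used.\<close>
  also have "\<dots> = (4 * (p / \<rho>)) ^ (2 ^ m)"
    by (simp add: power_mult flip: power_mult_distrib)
  also have "\<dots> \<le> (1 / 8) ^ (2 ^ m)"
    using p \<rho> by (intro power_mono) auto
  also have "\<dots> \<le> (1 / 8 :: real) ^ Suc m"
    by (intro power_decreasing) (auto simp: Suc_le_eq)
  \<comment> \<open>The bound is the geometric sum of \<open>(1 / 8) ^ i\<close> for
    \<open>1 \<le> i \<le> m\<close>; this round contributes the next term.\<close>
  also have "(1 - (1 / 8) ^ m) / 7 + (1 / 8) ^ Suc m = (1 - (1 / 8 :: real) ^ Suc m) / 7"
  proof -
    have "(1 - e) / 7 + 1 / 8 * e = (1 - 1 / 8 * e) / 7" for e :: real
      by (simp add: field_simps)
    then show ?thesis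
      unfolding power_Suc .
  qed
  finally show ?case
    by simp
qed

section \<open>Spread families and uniformly random sets\<close>

lemma bexp_half:
  assumes "finite V"
  shows "bexp (1 / 2) V f = (\<Sum>W\<in>Pow V. f W) / 2 ^ card V"
proof -
  have "(1 / 2) ^ card W * (1 - 1 / 2) ^ card (V - W) * f W = f W / 2 ^ card V" if "W \<in> Pow V" for W
  proof -
    have "card W + card (V - W) = card V"
      using assms that by (metis Pow_iff card_Diff_subset card_mono finite_subset le_add_diff_inverse)
    then have "(2::real) ^ card V = 2 ^ card W * 2 ^ card (V - W)"
      by (metis power_add)
    then show ?thesis
      by (simp add: power_one_over)
  qed
  then show ?thesis
    unfolding bexp_def sum_divide_distrib by (rule sum.cong[OF refl])
qed

lemma link_star: "link G X = (\<lambda>H. H - X) ` star G X"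
  unfolding link_def star_def by auto

lemma card_link: "card (link G X) = card (star G X)"
  unfolding link_star by (rule card_image) (auto simp: inj_on_def star_def)

lemma spread_iff:
  "spread r G \<longleftrightarrow>
    (\<forall>X. finite X \<longrightarrow> real (card (star G X)) \<le> (1 / r) ^ card X * real (card G))"
  by (simp add: spread_def card_link power_int_minus power_one_over inverse_eq_divide)

text \<open>By spreadness the members of \<open>H\<close> above \<open>T\<close> are at most a
  fraction \<open>(1 / r) ^ card T\<close>, and \<open>G\<close> is at least half of
  \<open>H\<close>; so every cover of \<open>G\<close> costs at least \<open>1 / 2\<close>. With
  \<open>c = 1 / 2\<close> the cost estimate bounds half the failure probability by less than
  \<open>1 / 4\<close>.\<close>

lemma most_sets_contain_member:
  fixes V :: "'a set"
  assumes V: "finite V" and r: "r > 2 ^ 12 * log 2 (2 * real k)" and k: "k \<ge> 1"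
    and H: "H \<subseteq> Pow V" "\<And>S. S \<in> H \<Longrightarrow> card S \<le> k" "spread r H"
    and G: "G \<subseteq> H" "G \<noteq> {}" "card H \<le> 2 * card G"
  shows "2 * card {W \<in> Pow V. \<exists>S\<in>G. S \<subseteq> W} > 2 ^ card V"
proof -
  \<comment> \<open>The least \<open>m\<close> with \<open>k < 2 ^ m\<close>: after \<open>m\<close>
    halvings only the empty set is left, and \<open>2 ^ m \<le> 2 * k\<close> gives
    \<open>m \<le> log 2 (2 * real k)\<close>.\<close>
  obtain j where j: "2 ^ j \<le> k" "k < 2 ^ (j + 1)"
    using ex_power_ivl1[of 2 k] k by auto
  define m where "m = j + 1"
  have m: "0 < m" "k < 2 ^ m"
    using j by (auto simp: m_def)
  have "log 2 (2 ^ m) \<le> log 2 (2 * real k)"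
  proof -
    have "real (2 ^ j) \<le> real k"
      using j(1) by (simp only: of_nat_le_iff)
    then show ?thesis
      using k by (subst log_le_cancel_iff) (auto simp: m_def)
  qed
  then have rm: "2 ^ 12 * real m < r"
    using r by (simp add: log_nat_power)
  have "r > 0"
    using rm m by (smt (verit) mult_nonneg_nonneg of_nat_0_le_iff zero_le_power)
  \<comment> \<open>Chosen so that the union of \<open>m\<close> samples of density
    \<open>\<rho>\<close> has density exactly \<open>1 / 2\<close>. Bernoulli's inequality then
    shows that \<open>\<rho>\<close> is at least \<open>1 / (2 * real m)\<close>.\<close>
  define \<rho> where "\<rho> = 1 - root m (1 / 2)"
  have "root m (1 / 2) \<le> 1 - 1 / (2 * real m)"
  proof -
    have "1 / 2 \<le> 1 + real m * (- 1 / (2 * real m))"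
      using m by simp
    also have "\<dots> \<le> (1 + (- 1 / (2 * real m))) ^ m"
      by (rule Bernoulli_inequality) (use m in simp)
    finally have "root m (1 / 2) \<le> root m ((1 - 1 / (2 * real m)) ^ m)"
      using m by simp
    also have "\<dots> = 1 - 1 / (2 * real m)"
      using m by (intro real_root_power_cancel) (auto simp: field_simps)
    finally show ?thesis .
  qed
  then have \<rho>_ge: "1 / (2 * real m) \<le> \<rho>"
    by (simp add: \<rho>_def)
  then have \<rho>: "0 < \<rho>" "\<rho> \<le> 1"
    using m by (auto simp: \<rho>_def intro: less_le_trans[rotated])
  have \<rho>_pow: "1 - (1 - \<rho>) ^ m = 1 / 2"
    using m by (simp add: \<rho>_def)
  \<comment> \<open>This yields the condition \<open>4 * (p / \<rho>) \<le> 1 / 8\<close> of the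
    cost estimate for \<open>p = 1 / r\<close>.\<close>
  have "1 / r \<le> 1 / (2 ^ 12 * real m)"
    using rm m by (intro divide_left_mono) auto
  also have "\<dots> \<le> \<rho> / 2 ^ 11"
    using \<rho>_ge m by (simp add: field_simps)
  finally have p: "1 / r \<le> \<rho> / 2 ^ 11" .
  have finH: "finite H"
    using H(1) V by (meson finite_Pow_iff finite_subset)
  then have finG: "finite G"
    using G(1) finite_subset by blast
  then have cardG: "0 < card G"
    using G(2) by (simp add: card_gt_0_iff)
  have "1 / 2 \<le> cost (1 / r) U" if U: "U \<subseteq> Pow V" "covers U G" for U
  proof -
    have finU: "finite U"
      using U(1) V by (meson finite_Pow_iff finite_subset)
    have "G \<subseteq> (\<Union>T\<in>U. star H T)"
      using U(2) G(1) unfolding covers_def star_def by auto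
    then have "card G \<le> card (\<Union>T\<in>U. star H T)"
      using finU finH by (intro card_mono) (auto simp: star_def)
    also have "\<dots> \<le> (\<Sum>T\<in>U. card (star H T))"
      using finU by (rule card_UN_le)
    finally have "real (card G) \<le> (\<Sum>T\<in>U. real (card (star H T)))"
      by (metis of_nat_le_iff of_nat_sum)
    also have "\<dots> \<le> (\<Sum>T\<in>U. (1 / r) ^ card T * real (card H))"
      using H(3) U(1) V unfolding spread_iff by (intro sum_mono) (auto intro: finite_subset)
    also have "\<dots> = cost (1 / r) U * real (card H)"
      by (simp add: cost_def sum_distrib_right)
    also have "\<dots> \<le> cost (1 / r) U * (2 * real (card G))"
      using G(3) \<open>r > 0\<close> by (intro mult_left_mono) (auto simp: cost_def intro!: sum_nonneg)
    finally show ?thesis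
      using cardG by (simp add: field_simps)
  qed
  then have "1 / 2 * bexp (1 - (1 - \<rho>) ^ m) V (misses G) \<le> (1 - (1 / 8) ^ m) / 7"
    using G(1) H(1) p \<rho> \<open>r > 0\<close> le_less_trans[OF H(2) m(2)]
    by (intro cover_cost_mult_misses[where p = "1 / r"] V \<rho>) (auto simp: field_simps)
  also have "\<dots> < 1 / 4"
  proof -
    have "(1 - e) / 7 < 1 / 4" if "0 < e" for e :: real
      using that by (simp add: field_simps)
    from this[of "(1 / 8) ^ m"] show ?thesis by simp
  qed
  finally have "bexp (1 / 2) V (misses G) < 1 / 2"
    unfolding \<rho>_pow by simp
  moreover have "(\<Sum>W\<in>Pow V. misses G W) =
      2 ^ card V - real (card {W \<in> Pow V. \<exists>S\<in>G. S \<subseteq> W})"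
  proof -
    have "(\<Sum>W\<in>Pow V. misses G W) = (\<Sum>W\<in>Pow V. 1 - of_bool (\<exists>S\<in>G. S \<subseteq> W))"
      by (rule sum.cong) (auto simp: misses_def)
    also have "\<dots> = 2 ^ card V - real (card {W \<in> Pow V. \<exists>S\<in>G. S \<subseteq> W})"
      using V by (simp add: sum_subtractf card_Pow Int_def)
    finally show ?thesis .
  qed
  ultimately have "2 ^ card V < 2 * real (card {W \<in> Pow V. \<exists>S\<in>G. S \<subseteq> W})"
    using V by (simp add: bexp_half field_simps)
  then have "real (2 ^ card V) < real (2 * card {W \<in> Pow V. \<exists>S\<in>G. S \<subseteq> W})"
    by simp
  then show ?thesis
    by (simp only: of_nat_less_iff)
qed

section \<open>Intersections of the chosen sets\<close>

text \<open>Complementation permutes the subsets of \<open>V\<close>. So more than half of all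
  \<open>W\<close> contain a member of \<open>G\<close>, and for more than half the complement
  contains a member of \<open>G'\<close>; some \<open>W\<close> does both.\<close>

lemma disjoint_members:
  assumes V: "finite V"
    and G: "2 * card {W \<in> Pow V. \<exists>S\<in>G. S \<subseteq> W} > 2 ^ card V"
    and G': "2 * card {W \<in> Pow V. \<exists>S\<in>G'. S \<subseteq> W} > 2 ^ card V"
  obtains S S' where "S \<in> G" "S' \<in> G'" "S \<inter> S' = {}"
proof -
  let ?X = "{W \<in> Pow V. \<exists>S\<in>G. S \<subseteq> W}" and ?Y = "{W \<in> Pow V. \<exists>S\<in>G'. S \<subseteq> W}"
  have "card ((\<lambda>W. V - W) ` ?Y) = card ?Y"
    by (rule card_image) (auto simp: inj_on_def)
  moreover have "?X \<inter> (\<lambda>W. V - W) ` ?Y \<noteq> {}"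
  proof
    assume "?X \<inter> (\<lambda>W. V - W) ` ?Y = {}"
    then have "card ?X + card ((\<lambda>W. V - W) ` ?Y) = card (?X \<union> (\<lambda>W. V - W) ` ?Y)"
      using V by (subst card_Un_disjoint) auto
    also have "\<dots> \<le> card (Pow V)"
      using V by (intro card_mono) auto
    finally show False
      using G G' \<open>card ((\<lambda>W. V - W) ` ?Y) = card ?Y\<close> V by (simp add: card_Pow)
  qed
  ultimately show thesis
    using that by blast
qed

text \<open>Union bound: each point of \<open>B\<close> lies in at most a fraction
  \<open>1 / r\<close> of \<open>H\<close>, so at most \<open>card B / r\<close>, hence at most
  half, of \<open>H\<close> meets \<open>B\<close>.\<close>

lemma card_le_twice_avoiding:
  assumes H: "finite H" "spread r H" and B: "finite B" "2 * real (card B) \<le> r" "0 < r"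
  shows "card H \<le> 2 * card {S \<in> H. S \<inter> B = {}}"
proof -
  have "H \<subseteq> {S \<in> H. S \<inter> B = {}} \<union> (\<Union>x\<in>B. star H {x})"
    unfolding star_def by auto
  then have "card H \<le> card ({S \<in> H. S \<inter> B = {}} \<union> (\<Union>x\<in>B. star H {x}))"
    using H(1) B(1) by (intro card_mono) (auto simp: star_def)
  also have "\<dots> \<le> card {S \<in> H. S \<inter> B = {}} + card (\<Union>x\<in>B. star H {x})"
    by (rule card_Un_le)
  also have "card (\<Union>x\<in>B. star H {x}) \<le> (\<Sum>x\<in>B. card (star H {x}))"
    using B(1) by (rule card_UN_le)
  finally have "real (card H) \<le> real (card {S \<in> H. S \<inter> B = {}} + (\<Sum>x\<in>B. card (star H {x})))"
    by (simp only: of_nat_le_iff add_le_cancel_left)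
  also have "\<dots> = real (card {S \<in> H. S \<inter> B = {}}) + (\<Sum>x\<in>B. real (card (star H {x})))"
    by simp
  also have "(\<Sum>x\<in>B. real (card (star H {x}))) \<le> (\<Sum>x\<in>B. (1 / r) * real (card H))"
    using H(2) unfolding spread_iff
    by (intro sum_mono) (metis card_1_singleton_iff finite.emptyI finite_insert power_one_right One_nat_def)
  also have "\<dots> = (real (card B) / r) * real (card H)"
    by simp
  also have "\<dots> \<le> 1 / 2 * real (card H)"
    using B by (intro mult_right_mono) (auto simp: field_simps)
  finally show ?thesis by linarith
qed

lemma t_intersecting_of_spread_links:
  assumes r: "r > 2 ^ 12 * log 2 (2 * real k)" "r \<ge> 2 * real q" and k: "k \<ge> 1"
    and V: "finite V" and F: "F \<subseteq> Pow V" "\<And>S. S \<in> F \<Longrightarrow> card S \<le> k" "t_intersecting t F"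
    and \<S>: "\<And>B. B \<in> \<S> \<Longrightarrow> B \<subseteq> V \<and> card B \<le> q \<and>
      (\<exists>G \<subseteq> F. link G B \<noteq> {} \<and> spread r (link G B))"
  shows "t_intersecting t \<S>"
  unfolding t_intersecting_def
proof (intro ballI)
  fix A B assume AB: "A \<in> \<S>" "B \<in> \<S>"
  have "0 \<le> log 2 (2 * real k)"
    using k by simp
  then have r0: "0 < r"
    using r(1) by (smt (verit) mult_nonneg_nonneg zero_le_power)
  \<comment> \<open>Used for both \<open>(A, B)\<close> and \<open>(B, A)\<close>. The case
    \<open>A = B\<close> is included and yields \<open>t \<le> card A\<close>.\<close>
  have avoid: "2 * card {W \<in> Pow V. \<exists>S\<in>{S. S \<inter> D = {} \<and> S \<inter> C = {} \<and> S \<union> C \<in> F}. S \<subseteq> W} > 2 ^ card V"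
    if CD: "C \<in> \<S>" "D \<in> \<S>" for C D
  proof -
    obtain G where G: "G \<subseteq> F" "link G C \<noteq> {}" "spread r (link G C)"
      using \<S>[OF CD(1)] by auto
    have finG: "finite G"
      using G(1) F(1) V by (meson finite_Pow_iff finite_subset)
    then have fin: "finite (link G C)"
      by (simp add: link_star star_def)
    have size: "card S \<le> k" if "S \<in> link G C" for S
    proof -
      from that obtain H where H: "H \<in> F" "S = H - C"
        using G(1) unfolding link_def by auto
      then have "finite H"
        using F(1) V by (auto intro: finite_subset)
      then have "card S \<le> card H"
        unfolding H(2) by (intro card_mono) auto
      then show ?thesis
        using F(2)[OF H(1)] by linarith
    qed
    have half: "card (link G C) \<le> 2 * card {S \<in> link G C. S \<inter> D = {}}"
      using \<S>[OF CD(2)] r(2) r0 V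
      by (intro card_le_twice_avoiding[OF fin G(3)]) (auto intro: finite_subset)
    \<comment> \<open>Here nonemptiness of the link enters: an empty link would be spread as
      well.\<close>
    have ne: "{S \<in> link G C. S \<inter> D = {}} \<noteq> {}"
      using half G(2) fin by (metis card_0_eq card.empty mult_0_right le_zero_eq)
    have "2 ^ card V < 2 * card {W \<in> Pow V. \<exists>S\<in>{S \<in> link G C. S \<inter> D = {}}. S \<subseteq> W}"
    proof (rule most_sets_contain_member[OF V r(1) k _ size G(3) _ ne half])
      show "link G C \<subseteq> Pow V"
        using G(1) F(1) unfolding link_def by auto
    qed auto
    also have "\<dots> \<le> 2 * card {W \<in> Pow V.
        \<exists>S\<in>{S. S \<inter> D = {} \<and> S \<inter> C = {} \<and> S \<union> C \<in> F}. S \<subseteq> W}"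
    proof -
      have "S \<inter> C = {} \<and> S \<union> C \<in> F" if "S \<in> link G C" for S
        using that G(1) unfolding link_def by (auto simp: Un_absorb2)
      then show ?thesis
        using V by (intro mult_left_mono card_mono) auto
    qed
    finally show ?thesis .
  qed
  obtain S S' where S: "S \<inter> B = {}" "S \<union> A \<in> F" "S' \<inter> A = {}" "S' \<union> B \<in> F" "S \<inter> S' = {}"
    by (rule disjoint_members[OF V avoid[OF AB] avoid[OF AB(2) AB(1)]], rule that, auto)
  then have "(S \<union> A) \<inter> (S' \<union> B) = A \<inter> B"
    by auto
  then show "t \<le> card (A \<inter> B)"
    using F(3) S(2,4) unfolding t_intersecting_def by metis
qed

section \<open>Greedy spread approximation\<close>

lemma link_link:
  assumes "X \<inter> S = {}"
  shows "link (link G S) X = link G (S \<union> X)"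
proof -
  have "star (link G S) X = (\<lambda>H. H - S) ` star G (S \<union> X)"
    using assms unfolding link_def star_def by auto
  then show ?thesis
    by (simp add: link_star[of _ X] link_star[of _ "S \<union> X"] image_image set_diff_eq conj_assoc)
qed

text \<open>For \<open>X\<close> disjoint from \<open>S\<close>, maximality bounds the sets above
  \<open>S \<union> X\<close> by a power with exponent \<open>card X + card S\<close>; the lower
  bound at \<open>S\<close> absorbs the part belonging to \<open>S\<close>.\<close>

lemma spread_link_of_maximal:
  assumes r: "0 < r"
    and S: "(1 / r) ^ card S * real (card G) \<le> real (card (star G S))" "finite S"
    and max: "\<And>S'. finite S' \<Longrightarrow> S \<subset> S' \<Longrightarrow> real (card (star G S')) \<le> (1 / r) ^ card S' * real (card G)"
  shows "spread r (link G S)"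
  unfolding spread_def
proof (intro allI impI)
  fix X :: "'a set" assume X: "finite X"
  consider "X = {}" | "X \<inter> S \<noteq> {}" | "X \<noteq> {}" "X \<inter> S = {}" by blast
  then have "real (card (link (link G S) X)) \<le> (1 / r) ^ card X * real (card (link G S))"
  proof cases
    case 1
    then show ?thesis by (simp add: link_def)
  next
    case 2
    then have "link (link G S) X = {}"
      unfolding link_def by auto
    then show ?thesis using r by simp
  next
    case 3
    then have "S \<subset> S \<union> X" by auto
    then have "real (card (link (link G S) X)) \<le> (1 / r) ^ card (S \<union> X) * real (card G)"
      using max[of "S \<union> X"] X S(2) 3 by (simp add: link_link card_link)
    also have "card (S \<union> X) = card X + card S"
      using X S(2) 3 by (subst card_Un_disjoint) auto
    also have "(1 / r) ^ (card X + card S) * real (card G)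
        = (1 / r) ^ card X * ((1 / r) ^ card S * real (card G))"
      by (simp add: power_add)
    also have "\<dots> \<le> (1 / r) ^ card X * real (card (link G S))"
      using S(1) r by (intro mult_left_mono) (auto simp: card_link)
    finally show ?thesis .
  qed
  then show "real (card (link (link G S) X)) \<le> r powi (- int (card X)) * real (card (link G S))"
    by (simp add: power_int_minus power_one_over inverse_eq_divide)
qed

text \<open>Induction on the size of the remaining family \<open>G\<close>, with the ambient family
  \<open>\<A>\<close> fixed. Links found later come from subfamilies of \<open>G\<close>, so they
  still qualify.\<close>

lemma greedy_spread_approximation:
  assumes V: "finite V" and \<A>: "\<A> \<subseteq> Pow V" "spread r0 \<A>" and r: "0 < r" "r < r0"
    and G: "G \<subseteq> \<A>"
  shows "\<exists>\<S> G'. (\<forall>B\<in>\<S>. B \<subseteq> V \<and> card B \<le> q) \<and> G' \<subseteq> G \<and> G - G' \<subseteq> star_family \<A> \<S>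
    \<and> (\<forall>B\<in>\<S>. \<exists>K \<subseteq> G. link K B \<noteq> {} \<and> spread r (link K B))
    \<and> real (card G') \<le> (r / r0) ^ (q + 1) * real (card \<A>)"
  using G
proof (induction "card G" arbitrary: G rule: less_induct)
  case less
  have finA: "finite \<A>"
    using \<A>(1) V by (meson finite_Pow_iff finite_subset)
  then have finG: "finite G"
    using less.prems finite_subset by blast
  show ?case
  proof (cases "G = {}")
    case True
    then show ?thesis
      using r by (intro exI[of _ "{}"]) (auto simp: star_family_def)
  next
    case False
    define P where "P = {S. S \<subseteq> V \<and> (1 / r) ^ card S * real (card G) \<le> real (card (star G S))}"
    have "finite P"
      unfolding P_def using V by simp
    \<comment> \<open>The empty set attains equality, so a maximal \<open>S\<close> exists.\<close>
    moreover have "{} \<in> P"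
      unfolding P_def star_def by simp
    ultimately obtain S where S: "S \<in> P" "\<And>S'. S' \<in> P \<Longrightarrow> S \<subseteq> S' \<Longrightarrow> S = S'"
      using finite_has_maximal[of P] by auto
    have SV: "S \<subseteq> V" and S_ge: "(1 / r) ^ card S * real (card G) \<le> real (card (star G S))"
      using S(1) by (auto simp: P_def)
    have finS: "finite S"
      using SV V finite_subset by blast
    have "0 < card G"
      using False finG by (simp add: card_gt_0_iff)
    then have "0 < (1 / r) ^ card S * real (card G)"
      using r by simp
    then have starS: "star G S \<noteq> {}"
      using S_ge by (intro notI) simp
    have spr: "spread r (link G S)"
    proof (rule spread_link_of_maximal[OF r(1) S_ge finS])
      fix S' assume "finite S'" "S \<subset> S'"
      then have "S' \<notin> P"
        using S(2) by blast
      show "real (card (star G S')) \<le> (1 / r) ^ card S' * real (card G)"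
      proof (cases "S' \<subseteq> V")
        case True
        then show ?thesis
          using \<open>S' \<notin> P\<close> by (simp add: P_def)
      next
        case False
        then have "star G S' = {}"
          using less.prems \<A>(1) unfolding star_def by blast
        then show ?thesis
          using r by simp
      qed
    qed
    show ?thesis
    proof (cases "card S \<le> q")
      case True
      define G1 where "G1 = G - star G S"
      have G1: "G1 \<subset> G"
        using starS unfolding G1_def star_def by auto
      then have "card G1 < card G" "G1 \<subseteq> \<A>"
        using finG less.prems by (auto intro: psubset_card_mono)
      from less.hyps[OF this] obtain \<S> G' where
        IH: "\<forall>B\<in>\<S>. B \<subseteq> V \<and> card B \<le> q" "G' \<subseteq> G1" "G1 - G' \<subseteq> star_family \<A> \<S>"
          "\<forall>B\<in>\<S>. \<exists>K \<subseteq> G1. link K B \<noteq> {} \<and> spread r (link K B)"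
          "real (card G') \<le> (r / r0) ^ (q + 1) * real (card \<A>)"
        by blast
      have "star G S \<subseteq> star \<A> S"
        using less.prems unfolding star_def by auto
      then have "G - G' \<subseteq> star_family \<A> (insert S \<S>)"
        using IH(3) unfolding G1_def star_family_def by blast
      moreover have "\<exists>K \<subseteq> G. link K B \<noteq> {} \<and> spread r (link K B)" if B: "B \<in> insert S \<S>" for B
      proof (cases "B = S")
        case True
        then show ?thesis
          using spr starS by (auto simp: link_star)
      next
        case False
        then have "B \<in> \<S>"
          using B by simp
        from bspec[OF IH(4) this]
        obtain K where "K \<subseteq> G1" "link K B \<noteq> {}" "spread r (link K B)"
          by (elim exE conjE) (rule that)
        then show ?thesis
          using G1 by (intro exI[of _ K]) auto
      qed
      ultimately show ?thesis
        using IH(1,2,5) SV True G1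
        by (intro exI[of _ "insert S \<S>"] exI[of _ G']) auto
    next
      case False
      \<comment> \<open>The process stops and all of \<open>G\<close> becomes \<open>G'\<close>.
        Comparing the lower bound at \<open>S\<close> in \<open>G\<close> with the upper bound in
        \<open>\<A>\<close> gives the ratio \<open>r / r0\<close>, which is below 1, so
        \<open>card S \<ge> q + 1\<close> suffices.\<close>
      have "(1 / r) ^ card S * real (card G) \<le> real (card (star \<A> S))"
      proof -
        have "card (star G S) \<le> card (star \<A> S)"
          using less.prems finA by (intro card_mono) (auto simp: star_def)
        then show ?thesis
          using S_ge by linarith
      qed
      also have "\<dots> \<le> (1 / r0) ^ card S * real (card \<A>)"
        using \<A>(2) finS by (simp add: spread_iff)
      finally have "real (card G) \<le> (r / r0) ^ card S * real (card \<A>)"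
        using r by (simp add: power_divide field_simps)
      also have "\<dots> \<le> (r / r0) ^ (q + 1) * real (card \<A>)"
        using False r by (intro mult_right_mono power_decreasing) auto
      finally show ?thesis
        by (intro exI[of _ "{}"] exI[of _ G]) (auto simp: star_family_def)
    qed
  qed
qed

text \<open>The condition \<open>link \<F>\<^sub>B B \<noteq> {}\<close> gives (ii) its content: the
  empty family is spread, so otherwise \<open>\<F>\<^sub>B = {}\<close> would do for every
  \<open>B\<close>.\<close>

theorem theorem11:
  fixes n k t q :: nat and r r0 :: real
    and \<A> \<F> :: "nat set set"
  assumes "n \<ge> 1" and "k \<ge> 1" and "t \<ge> 1"
    and "\<A> \<subseteq> Pow {1..n}"
    and "\<F> \<subseteq> \<A> \<inter> subsets_upto n k"
    and "t_intersecting t \<F>"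
    and "q \<ge> 1" and "r \<ge> 1" and "r0 \<ge> 1"
    and "r > 2 ^ 12 * log 2 (2 * real k)"
    and "r \<ge> 2 * real q"
    and "r0 > r"
    and "spread r0 \<A>"
  shows "\<exists>\<S> \<F>'. \<S> \<subseteq> subsets_upto n q \<and> t_intersecting t \<S> \<and> \<F>' \<subseteq> \<F>
    \<and> \<F> - \<F>' \<subseteq> star_family \<A> \<S>
    \<and> (\<forall>B\<in>\<S>. \<exists>\<F>\<^sub>B. \<F>\<^sub>B \<subseteq> \<F> \<and> link \<F>\<^sub>B B \<noteq> {} \<and> spread r (link \<F>\<^sub>B B))
    \<and> real (card \<F>') \<le> (r0 / r) powi (- int q - 1) * real (card \<A>)"
proof -
  have \<A>: "\<A> \<subseteq> Pow {1..n}" and FA: "\<F> \<subseteq> \<A>" and Fk: "\<And>S. S \<in> \<F> \<Longrightarrow> card S \<le> k"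
    using assms(4,5) by (auto simp: subsets_upto_def)
  have r: "0 < r"
    using assms(8) by linarith
  obtain \<S> \<F>' where \<S>: "\<forall>B\<in>\<S>. B \<subseteq> {1..n} \<and> card B \<le> q"
      "\<F>' \<subseteq> \<F>" "\<F> - \<F>' \<subseteq> star_family \<A> \<S>"
      "\<forall>B\<in>\<S>. \<exists>K \<subseteq> \<F>. link K B \<noteq> {} \<and> spread r (link K B)"
      "real (card \<F>') \<le> (r / r0) ^ (q + 1) * real (card \<A>)"
    using greedy_spread_approximation[OF finite_atLeastAtMost \<A> assms(13) r assms(12) FA, of q]
    by (elim exE conjE) (rule that)
  have "t_intersecting t \<S>"
    using \<S>(1,4) \<A> FA
    by (intro t_intersecting_of_spread_links[OF assms(10,11,2) _ _ Fk assms(6), of "{1..n}"]) auto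
  moreover have "(r / r0) ^ (q + 1) = (r0 / r) powi (- int q - 1)"
  proof -
    have "- int q - 1 = - int (q + 1)"
      by simp
    then have "(r0 / r) powi (- int q - 1) = inverse ((r0 / r) ^ (q + 1))"
      by (simp only: power_int_minus power_int_of_nat)
    then show ?thesis
      by (simp only: power_inverse[symmetric] inverse_divide)
  qed
  moreover have "\<S> \<subseteq> subsets_upto n q"
    using \<S>(1) by (auto simp: subsets_upto_def)
  ultimately show ?thesis
    using \<S>(2-5) by (intro exI[of _ \<S>] exI[of _ \<F>']) (auto simp only:)
qed

end
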